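(* Let $\alpha$ be a positive rational number and let $\mathcal P_\alpha=(P,\nu)$ be a maximal primitive factorization tree for $\alpha$. Then $\mathcal P_\alpha$ is a primitive factorization tree, and: (i) $\nu(V(P))=\mathfrak P_\alpha$; (ii) if $\mathcal T$ is any primitive factorization tree for $\alpha$, then there exists a unique homomorphism $\sigma:V(\mathcal T)\to V(P)$, and $\sigma$ is injective and edge-preserving; (iii) if $\alpha$ is square-free and $\mathcal T=(T,\nu_0)$ is a primitive factorization tree for $\alpha$ such that every primitive factorization of $\alpha$ belongs to $\nu_0(V(T))$, then $\mathcal T\cong\mathcal P_\alpha$.
   Context: Write $\alpha=a/b$ with $a,b$ coprime positive integers; $\alpha$ is square-free if $a$ and $b$ are both square-free. Let $p_1\ge\cdots\ge p_N$ be the primes dividing $ab$, listed with multiplicity. Put $\gamma(i)=1$ if $p_i\mid a$, $\gamma(i)=-1$ if $p_i\mid b$, and $\alpha_n=\prod_{i=1}^n p_i^{\gamma(i)}$ for $0\le n\le N$. A factorization of a positive rational $\beta$ is a sequence $(a_1/b_1,a_2/b_2,\dots)$ with $a_i,b_i$ positive integers, $a_i=b_i=1$ for all but finitely many $i$, $\prod_i a_i/b_i=\beta$, $\max\{a_i,b_i\}\ge\max\{a_{i+1},b_{i+1}\}$ for all $i$, and $\gcd(a_i,b_j)=1$ for all $i,j$. It is primitive if $\max\{a_i,b_i\}$ is prime or equal to $1$ for every $i$. Let $\mathfrak F_\alpha$ (resp. $\mathfrak P_\alpha$) be the set of all (resp. all primitive) factorizations of $\alpha_n$, $0\le n\le N$.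 For $0\le n<N$, a factorization $(a_i/b_i)$ of $\alpha_n$ is a direct subfactorization of a factorization $(c_i/d_i)$ of $\alpha_{n+1}$ if either $p_{n+1}\mid a$ and for some $k$: $d_i=b_i$ for all $i$, $c_i=a_i$ for $i\ne k$, $c_k=a_kp_{n+1}$; or $p_{n+1}\mid b$ and for some $k$: $c_i=a_i$ for all $i$, $d_i=b_i$ for $i\ne k$, $d_k=b_kp_{n+1}$. A tree data structure for a set $X$ is a pair $(T,\nu)$ with $T$ a rooted tree (digraph with edges from each vertex to its children) and $\nu:V(T)\to X$ a map; $\phi$ is the parenting map and $\mathcal C(r)$ the set of children of $r$. A factorization tree for $\alpha$ is a tree data structure $(T,\nu)$ for $\mathfrak F_\alpha$ with: (1) root $r_0$ has $\nu(r_0)=(1,1,\dots)$; (2) if $n<N$ and $\nu(r)$ is a factorization of $\alpha_n$ then $r$ has a child; (3) $\nu(r)=\nu(s)$ and $\phi(r)=\phi(s)$ imply $r=s$; (4) for non-root $r$, $\nu(\phi(r))$ is a direct subfactorization of $\nu(r)$. It is a primitive factorization tree if $\nu(V(T))\subseteq\mathfrak P_\alpha$. For $0\le n<N$ and a factorization $\mathbf A=(a_1/b_1,\dots,a_\ell/b_\ell,1,1,\dots)$ of $\alpha_n$ with $a_\ell/b_\ell\ne1$ ($\ell=0$ if $\mathbf A=(1,1,\dots)$): if $p_{n+1}\mid a$, $\delta(\mathbf A)$ is the set of sequences obtained from $\mathbf A$ by replacing $a_k/b_k$ by $a_kp_{n+1}/b_k$ for some $k$ with $a_kp_{n+1}<b_k$,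 and $\epsilon(\mathbf A)=\{(a_1/b_1,\dots,a_\ell/b_\ell,p_{n+1}/1,1,\dots)\}$; if $p_{n+1}\mid b$, $\delta(\mathbf A)$ consists of sequences obtained by replacing $a_k/b_k$ by $a_k/(b_kp_{n+1})$ for some $k$ with $b_kp_{n+1}<a_k$, and $\epsilon(\mathbf A)=\{(a_1/b_1,\dots,a_\ell/b_\ell,1/p_{n+1},1,\dots)\}$. $\Delta(\mathbf A)=\delta(\mathbf A)\cup\epsilon(\mathbf A)$. A maximal primitive factorization tree for $\alpha$ is a factorization tree with $\nu(\mathcal C(r))=\Delta(\nu(r))$ for every non-leaf vertex $r$. A homomorphism $(T_1,\nu_1)\to(T_2,\nu_2)$ is a map $\sigma:V(T_1)\to V(T_2)$ with $(\sigma(g),\sigma(h))\in E(T_2)$ whenever $(g,h)\in E(T_1)$ and $\nu_2\circ\sigma=\nu_1$; it is edge-preserving if moreover $(\sigma(g),\sigma(h))\in E(T_2)$ implies $(g,h)\in E(T_1)$. An isomorphism is a bijective edge-preserving homomorphism; $\cong$ means one exists. *)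

theory Defs
  imports
    "HOL-Library.FuncSet"
    "HOL-Computational_Algebra.Computational_Algebra"
    "Graph_Theory.Pair_Digraph"
begin

section \<open>Prime factors of a positive rational\<close>

definition numer :: "rat \<Rightarrow> nat" where
  "numer \<alpha> = nat (fst (quotient_of \<alpha>))"

definition denom :: "rat \<Rightarrow> nat" where
  "denom \<alpha> = nat (snd (quotient_of \<alpha>))"

definition squarefree_rat :: "rat \<Rightarrow> bool" where
  "squarefree_rat \<alpha> \<longleftrightarrow> squarefree (numer \<alpha>) \<and> squarefree (denom \<alpha>)"

text \<open>The primes dividing \<open>a b\<close> with multiplicity, in non-increasing order. List positions and
  sequence positions start at 0 throughout, so the prime \<open>p\<^sub>n\<^sub>+\<^sub>1\<close> is \<open>prime_list \<alpha> ! n\<close>.\<close>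

definition prime_list :: "rat \<Rightarrow> nat list" where
  "prime_list \<alpha> = rev (sorted_list_of_multiset (prime_factorization (numer \<alpha> * denom \<alpha>)))"

definition num_primes :: "rat \<Rightarrow> nat" where
  "num_primes \<alpha> = length (prime_list \<alpha>)"

definition prime_sign :: "rat \<Rightarrow> nat \<Rightarrow> int" where
  "prime_sign \<alpha> i = (if prime_list \<alpha> ! i dvd numer \<alpha> then 1 else -1)"

definition partial_rat :: "rat \<Rightarrow> nat \<Rightarrow> rat" where
  "partial_rat \<alpha> n = (\<Prod>i<n. of_nat (prime_list \<alpha> ! i) powi prime_sign \<alpha> i)"

section \<open>Factorizations\<close>

text \<open>A pair \<open>(a, b)\<close> stands for the fraction \<open>a/b\<close>. In a factorization all these fractions are
  reduced (the coprimality condition for \<open>i = j\<close>), so a sequence of pairs and the sequence of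
  fractions it stands for determine each other, and \<open>(1, 1)\<close> is the only pair that stands for 1.\<close>

type_synonym frac_seq = "nat \<Rightarrow> nat \<times> nat"

definition one_seq :: frac_seq where
  "one_seq = (\<lambda>i. (1, 1))"

abbreviation frac_max :: "nat \<times> nat \<Rightarrow> nat" where
  "frac_max x \<equiv> max (fst x) (snd x)"

definition factorization :: "rat \<Rightarrow> frac_seq \<Rightarrow> bool" where
  "factorization \<beta> A \<longleftrightarrow>
     (\<forall>i. fst (A i) > 0 \<and> snd (A i) > 0) \<and>
     finite {i. A i \<noteq> (1, 1)} \<and>
     (\<Prod>i | A i \<noteq> (1, 1). of_nat (fst (A i)) / of_nat (snd (A i))) = \<beta> \<and>
     (\<forall>i. frac_max (A i) \<ge> frac_max (A (Suc i))) \<and>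
     (\<forall>i j. coprime (fst (A i)) (snd (A j)))"

definition primitive_factorization :: "rat \<Rightarrow> frac_seq \<Rightarrow> bool" where
  "primitive_factorization \<beta> A \<longleftrightarrow>
     factorization \<beta> A \<and> (\<forall>i. prime (frac_max (A i)) \<or> frac_max (A i) = 1)"

definition Factorizations :: "rat \<Rightarrow> frac_seq set" where
  "Factorizations \<alpha> = {A. \<exists>n\<le>num_primes \<alpha>. factorization (partial_rat \<alpha> n) A}"

definition Primitive_Factorizations :: "rat \<Rightarrow> frac_seq set" where
  "Primitive_Factorizations \<alpha> =
     {A. \<exists>n\<le>num_primes \<alpha>. primitive_factorization (partial_rat \<alpha> n) A}"

definition direct_subfactorization :: "rat \<Rightarrow> frac_seq \<Rightarrow> frac_seq \<Rightarrow> bool" where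
  "direct_subfactorization \<alpha> A C \<longleftrightarrow>
     (\<exists>n<num_primes \<alpha>.
        factorization (partial_rat \<alpha> n) A \<and> factorization (partial_rat \<alpha> (Suc n)) C \<and>
        (prime_list \<alpha> ! n dvd numer \<alpha> \<and>
           (\<exists>k. (\<forall>i. snd (C i) = snd (A i)) \<and> (\<forall>i. i \<noteq> k \<longrightarrow> fst (C i) = fst (A i)) \<and>
                fst (C k) = fst (A k) * prime_list \<alpha> ! n) \<or>
         prime_list \<alpha> ! n dvd denom \<alpha> \<and>
           (\<exists>k. (\<forall>i. fst (C i) = fst (A i)) \<and> (\<forall>i. i \<noteq> k \<longrightarrow> snd (C i) = snd (A i)) \<and>
                snd (C k) = snd (A k) * prime_list \<alpha> ! n)))"

text \<open>The number \<open>\<ell>\<close> of entries up to and including the last one different from 1.\<close>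

definition seq_length :: "frac_seq \<Rightarrow> nat" where
  "seq_length A = (LEAST l. \<forall>i\<ge>l. A i = (1, 1))"

text \<open>Every prime in the list divides exactly one of numerator and denominator, so the \<open>else\<close>
  branches below are the case of a prime dividing the denominator.\<close>

definition delta :: "rat \<Rightarrow> nat \<Rightarrow> frac_seq \<Rightarrow> frac_seq set" where
  "delta \<alpha> n A = (let p = prime_list \<alpha> ! n in
     if p dvd numer \<alpha>
     then {A(k := (fst (A k) * p, snd (A k))) | k. fst (A k) * p < snd (A k)}
     else {A(k := (fst (A k), snd (A k) * p)) | k. snd (A k) * p < fst (A k)})"

definition epsilon :: "rat \<Rightarrow> nat \<Rightarrow> frac_seq \<Rightarrow> frac_seq set" where
  "epsilon \<alpha> n A = (let p = prime_list \<alpha> ! n in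
     {A(seq_length A := (if p dvd numer \<alpha> then (p, 1) else (1, p)))})"

text \<open>The index \<open>n\<close> is determined by \<open>A\<close>: the rationals \<open>partial_rat \<alpha> n\<close> with
  \<open>n \<le> num_primes \<alpha>\<close> are distinct. So the union below has at most one member.\<close>

definition Delta :: "rat \<Rightarrow> frac_seq \<Rightarrow> frac_seq set" where
  "Delta \<alpha> A =
     (\<Union>n \<in> {n. n < num_primes \<alpha> \<and> factorization (partial_rat \<alpha> n) A}.
        delta \<alpha> n A \<union> epsilon \<alpha> n A)"

section \<open>Tree data structures\<close>

text \<open>Only the values of \<open>label\<close> on the vertices are meaningful.\<close>

record ('v, 'x) tree_data =
  graph :: "'v pair_pre_digraph"
  root :: 'v
  label :: "'v \<Rightarrow> 'x"

abbreviation vertices :: "('v, 'x) tree_data \<Rightarrow> 'v set" where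
  "vertices T \<equiv> pverts (graph T)"

abbreviation edges :: "('v, 'x) tree_data \<Rightarrow> 'v rel" where
  "edges T \<equiv> parcs (graph T)"

text \<open>A tree with all edges directed away from the root. The predicate \<open>tree\<close> of Graph_Theory does
  not fit: it asks for connectedness of the underlying undirected graph but only excludes directed
  cycles. No finiteness is assumed.\<close>

definition rooted_tree :: "'v pair_pre_digraph \<Rightarrow> 'v \<Rightarrow> bool" where
  "rooted_tree G r \<longleftrightarrow>
     pair_wf_digraph G \<and> r \<in> pverts G \<and>
     (\<forall>u. (u, r) \<notin> parcs G) \<and>
     (\<forall>v \<in> pverts G - {r}. \<exists>!u. (u, v) \<in> parcs G) \<and>
     (\<forall>v \<in> pverts G. reachable (with_proj G) r v)"

definition parent :: "('v, 'x) tree_data \<Rightarrow> 'v \<Rightarrow> 'v" where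
  "parent T v = (THE u. (u, v) \<in> edges T)"

definition children :: "('v, 'x) tree_data \<Rightarrow> 'v \<Rightarrow> 'v set" where
  "children T v = {w. (v, w) \<in> edges T}"

definition tree_data_structure :: "'x set \<Rightarrow> ('v, 'x) tree_data \<Rightarrow> bool" where
  "tree_data_structure X T \<longleftrightarrow>
     rooted_tree (graph T) (root T) \<and> label T \<in> vertices T \<rightarrow> X"

definition factorization_tree :: "rat \<Rightarrow> ('v, frac_seq) tree_data \<Rightarrow> bool" where
  "factorization_tree \<alpha> T \<longleftrightarrow>
     tree_data_structure (Factorizations \<alpha>) T \<and>
     label T (root T) = one_seq \<and>
     (\<forall>r \<in> vertices T. \<forall>n < num_primes \<alpha>.
        factorization (partial_rat \<alpha> n) (label T r) \<longrightarrow> children T r \<noteq> {}) \<and>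
     (\<forall>r \<in> vertices T - {root T}. \<forall>s \<in> vertices T - {root T}.
        label T r = label T s \<and> parent T r = parent T s \<longrightarrow> r = s) \<and>
     (\<forall>r \<in> vertices T - {root T}.
        direct_subfactorization \<alpha> (label T (parent T r)) (label T r))"

definition primitive_factorization_tree :: "rat \<Rightarrow> ('v, frac_seq) tree_data \<Rightarrow> bool" where
  "primitive_factorization_tree \<alpha> T \<longleftrightarrow>
     factorization_tree \<alpha> T \<and> label T ` vertices T \<subseteq> Primitive_Factorizations \<alpha>"

definition maximal_primitive_factorization_tree :: "rat \<Rightarrow> ('v, frac_seq) tree_data \<Rightarrow> bool" where
  "maximal_primitive_factorization_tree \<alpha> T \<longleftrightarrow>
     factorization_tree \<alpha> T \<and>
     (\<forall>r \<in> vertices T. children T r \<noteq> {} \<longrightarrow> label T ` children T r = Delta \<alpha> (label T r))"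

section \<open>Homomorphisms\<close>

text \<open>A homomorphism is a map on the vertex set. It is represented by an extensional function
  (undefined outside the vertex set), so that equality of HOL functions is equality of maps.\<close>

definition tree_hom :: "('v, 'x) tree_data \<Rightarrow> ('w, 'x) tree_data \<Rightarrow> ('v \<Rightarrow> 'w) \<Rightarrow> bool" where
  "tree_hom T1 T2 \<sigma> \<longleftrightarrow>
     \<sigma> \<in> vertices T1 \<rightarrow>\<^sub>E vertices T2 \<and>
     (\<forall>g h. (g, h) \<in> edges T1 \<longrightarrow> (\<sigma> g, \<sigma> h) \<in> edges T2) \<and>
     (\<forall>v \<in> vertices T1. label T2 (\<sigma> v) = label T1 v)"

definition edge_preserving :: "('v, 'x) tree_data \<Rightarrow> ('w, 'x) tree_data \<Rightarrow> ('v \<Rightarrow> 'w) \<Rightarrow> bool" where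
  "edge_preserving T1 T2 \<sigma> \<longleftrightarrow>
     (\<forall>g \<in> vertices T1. \<forall>h \<in> vertices T1. (\<sigma> g, \<sigma> h) \<in> edges T2 \<longrightarrow> (g, h) \<in> edges T1)"

definition tree_isomorphic :: "('v, 'x) tree_data \<Rightarrow> ('w, 'x) tree_data \<Rightarrow> bool" where
  "tree_isomorphic T1 T2 \<longleftrightarrow>
     (\<exists>\<sigma>. tree_hom T1 T2 \<sigma> \<and> edge_preserving T1 T2 \<sigma> \<and> bij_betw \<sigma> (vertices T1) (vertices T2))"

end

theory Submission
  imports Defs
begin

text \<open>Since the primes are added in non-increasing order, a primitive factorization of
  \<open>\<alpha>\<^sub>n\<^sub>+\<^sub>1\<close> arises from one of \<open>\<alpha>\<^sub>n\<close> either by putting the new prime on the smaller side of an entry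
  or by appending it as a new last entry, so the primitive direct superfactorizations of \<open>A\<close> are
  exactly the factorizations in \<open>Delta \<alpha> A\<close>. Conversely, the new prime can always be removed from a
  primitive factorization. Hence the labels of the maximal tree are all primitive factorizations,
  and every primitive factorization tree embeds into it by matching paths of labels. If \<open>\<alpha>\<close> is
  square-free, the new prime occurs in only one place, so the vertices of the maximal tree are
  determined by their labels, and every vertex has a descendant labelled by a factorization of \<open>\<alpha>\<close>.\<close>

section \<open>Exchanging the roles of numerator and denominator\<close>

text \<open>\<open>True\<close> selects the numerator and \<open>False\<close> the denominator. With
  \<open>on_top \<alpha> n\<close> for the boolean, the case of a prime dividing the numerator and
  its mirror image become one argument.\<close>

definition side :: "bool \<Rightarrow> nat \<times> nat \<Rightarrow> nat" where
  "side b x = (if b then fst x else snd x)"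

definition scale :: "bool \<Rightarrow> nat \<Rightarrow> nat \<times> nat \<Rightarrow> nat \<times> nat" where
  "scale b p x = (if b then (fst x * p, snd x) else (fst x, snd x * p))"

lemma side_scale: "side b' (scale b p x) = (if b' = b then side b x * p else side b' x)"
  by (auto simp: side_def scale_def)

lemma side_one [simp]: "side b (Suc 0, Suc 0) = 1"
  by (simp add: side_def)

lemma frac_max_side: "frac_max x = max (side b x) (side (\<not> b) x)"
  by (simp add: side_def max.commute)

lemma scale_inject: "p > 0 \<Longrightarrow> scale b p x = scale b p y \<longleftrightarrow> x = y"
  by (auto simp: scale_def prod_eq_iff)

lemma common_prime_factor:
  fixes m n :: nat
  assumes "\<not> coprime m n"
  obtains q where "prime q" "q dvd m" "q dvd n"
proof -
  obtain d where "d dvd m" "d dvd n" "d \<noteq> 1" using assms by (auto elim: not_coprimeE)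
  moreover then obtain q where "prime q" "q dvd d" using prime_factor_nat by blast
  ultimately show thesis using that by (meson dvd_trans)
qed

lemma quotient_of_pos:
  assumes "\<alpha> > 0"
  shows "fst (quotient_of \<alpha>) > 0"
proof -
  have "\<alpha> = of_int (fst (quotient_of \<alpha>)) / of_int (snd (quotient_of \<alpha>))"
    by (metis prod.collapse quotient_of_div)
  then show ?thesis
    using assms quotient_of_denom_pos'[of \<alpha>] by (metis of_int_0_less_iff zero_less_divide_iff less_asym)
qed

section \<open>The prime list\<close>

lemma prime_list_prime: "n < num_primes \<alpha> \<Longrightarrow> prime (prime_list \<alpha> ! n)"
  by (metis in_prime_factors_imp_prime nth_mem num_primes_def prime_list_def set_rev
      set_sorted_list_of_multiset)

lemma prime_list_antimono:
  assumes "i \<le> j" "j < num_primes \<alpha>"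
  shows "prime_list \<alpha> ! j \<le> prime_list \<alpha> ! i"
proof -
  let ?s = "sorted_list_of_multiset (prime_factorization (numer \<alpha> * denom \<alpha>))"
  have "sorted ?s" by simp
  then show ?thesis
    using assms by (auto simp: prime_list_def num_primes_def rev_nth intro!: sorted_nth_mono)
qed

text \<open>\<open>nat\<close> turns a negative numerator into 0, and coprimality can then fail, as
  for -1/2; a nonzero \<open>numer\<close> inherits it from \<open>quotient_of\<close>.\<close>

lemma coprime_numer_denom:
  assumes "numer \<alpha> \<noteq> 0"
  shows "coprime (numer \<alpha>) (denom \<alpha>)"
proof -
  have "coprime (fst (quotient_of \<alpha>)) (snd (quotient_of \<alpha>))"
    by (metis prod.collapse quotient_of_coprime)
  moreover have "snd (quotient_of \<alpha>) > 0" by (rule quotient_of_denom_pos')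
  ultimately have "coprime (int (numer \<alpha>)) (int (denom \<alpha>))"
    using assms by (simp add: numer_def denom_def)
  then show ?thesis by simp
qed

lemma prime_list_dvd_denom_iff:
  assumes "n < num_primes \<alpha>"
  shows "prime_list \<alpha> ! n dvd denom \<alpha> \<longleftrightarrow> \<not> prime_list \<alpha> ! n dvd numer \<alpha>"
proof -
  let ?p = "prime_list \<alpha> ! n"
  have "?p \<in> set (prime_list \<alpha>)" using assms by (simp add: num_primes_def)
  then have p: "?p \<in> prime_factors (numer \<alpha> * denom \<alpha>)" by (simp add: prime_list_def)
  then have "prime ?p" "?p dvd numer \<alpha> * denom \<alpha>" by auto
  then have "?p dvd numer \<alpha> \<or> ?p dvd denom \<alpha>" by (simp add: prime_dvd_mult_iff)
  \<comment> \<open>A zero numerator would make the product 0, whose prime factorization is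
    empty.\<close>
  moreover have "numer \<alpha> \<noteq> 0"
  proof
    assume "numer \<alpha> = 0"
    then show False using p by simp
  qed
  ultimately show ?thesis
    using coprime_numer_denom \<open>prime ?p\<close> by (metis coprime_common_divisor not_prime_unit)
qed

section \<open>Numerators and denominators of the partial products\<close>

abbreviation on_top :: "rat \<Rightarrow> nat \<Rightarrow> bool" where
  "on_top \<alpha> n \<equiv> prime_list \<alpha> ! n dvd numer \<alpha>"

text \<open>For \<open>n \<le> num_primes \<alpha>\<close> this is the numerator or denominator of
  \<open>partial_rat \<alpha> n\<close> in lowest terms.\<close>

definition partial_side :: "rat \<Rightarrow> bool \<Rightarrow> nat \<Rightarrow> nat" where
  "partial_side \<alpha> b n = (\<Prod>i<n. if on_top \<alpha> i = b then prime_list \<alpha> ! i else 1)"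

lemma partial_side_Suc:
  "partial_side \<alpha> b (Suc n) =
     partial_side \<alpha> b n * (if on_top \<alpha> n = b then prime_list \<alpha> ! n else 1)"
  by (simp add: partial_side_def)

lemma partial_side_pos: "n \<le> num_primes \<alpha> \<Longrightarrow> partial_side \<alpha> b n > 0"
  unfolding partial_side_def by (intro prod_pos) (auto intro!: prime_gt_0_nat prime_list_prime)

lemma prime_dvd_partial_side:
  assumes "prime q" "q dvd partial_side \<alpha> b n" "n \<le> num_primes \<alpha>"
  obtains i where "i < n" "q = prime_list \<alpha> ! i" "on_top \<alpha> i = b"
proof -
  obtain i where i: "i < n" "q dvd (if on_top \<alpha> i = b then prime_list \<alpha> ! i else 1)"
    using assms(1,2) by (auto simp: partial_side_def prime_dvd_prod_iff)
  moreover have "prime (prime_list \<alpha> ! i)" using i(1) assms(3) by (simp add: prime_list_prime)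
  ultimately show thesis
    using that assms(1) by (metis not_prime_unit primes_dvd_imp_eq)
qed

text \<open>\<open>on_top\<close> depends only on the value of the prime, so equal primes in the
  list are counted on the same side.\<close>

lemma coprime_partial_side:
  assumes "n \<le> num_primes \<alpha>"
  shows "coprime (partial_side \<alpha> b n) (partial_side \<alpha> (\<not> b) n)"
proof (rule ccontr)
  assume "\<not> ?thesis"
  then obtain q where "prime q" "q dvd partial_side \<alpha> b n" "q dvd partial_side \<alpha> (\<not> b) n"
    by (rule common_prime_factor)
  then show False by (metis assms prime_dvd_partial_side)
qed

lemma partial_rat_eq:
  "partial_rat \<alpha> n = of_nat (partial_side \<alpha> True n) / of_nat (partial_side \<alpha> False n)"
  by (induction n)
    (auto simp: partial_rat_def partial_side_def prime_sign_def power_int_minus divide_inverse)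

text \<open>The two sides multiply to \<open>numer \<alpha> * denom \<alpha>\<close>, and each is
  coprime to the opposite one of these two factors, which fixes how the product splits.\<close>

lemma partial_side_num_primes:
  assumes "\<alpha> > 0"
  shows "partial_side \<alpha> b (num_primes \<alpha>) = side b (numer \<alpha>, denom \<alpha>)"
proof -
  let ?N = "num_primes \<alpha>"
  have d: "denom \<alpha> \<noteq> 0"
    using quotient_of_denom_pos'[of \<alpha>] by (simp add: denom_def)
  have n: "numer \<alpha> \<noteq> 0"
    using quotient_of_pos[OF assms] by (simp add: numer_def)
  have "partial_side \<alpha> True ?N * partial_side \<alpha> False ?N = (\<Prod>i<?N. prime_list \<alpha> ! i)"
    by (auto simp: partial_side_def simp flip: prod.distrib intro!: prod.cong)
  also have "\<dots> = prod_list (prime_list \<alpha>)"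
    by (simp add: num_primes_def prod.list_conv_set_nth lessThan_atLeast0)
  also have "\<dots> = prod_mset (prime_factorization (numer \<alpha> * denom \<alpha>))"
    by (simp add: prime_list_def flip: prod_mset_prod_list)
  also have "\<dots> = numer \<alpha> * denom \<alpha>"
    using n d by (simp add: prod_mset_prime_factorization_nat)
  finally have eq: "partial_side \<alpha> True ?N * partial_side \<alpha> False ?N = numer \<alpha> * denom \<alpha>" .
  have cop: "coprime (partial_side \<alpha> b ?N) (side (\<not> b) (numer \<alpha>, denom \<alpha>))" for b
  proof (rule ccontr)
    assume "\<not> ?thesis"
    then obtain q where q: "prime q" "q dvd partial_side \<alpha> b ?N"
      "q dvd side (\<not> b) (numer \<alpha>, denom \<alpha>)"
      by (rule common_prime_factor)
    obtain i where "i < ?N" "q = prime_list \<alpha> ! i" "on_top \<alpha> i = b"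
      using prime_dvd_partial_side[OF q(1,2) order_refl] .
    with q(3) show False using prime_list_dvd_denom_iff[of i \<alpha>]
      by (auto simp: side_def split: if_splits)
  qed
  have "partial_side \<alpha> True ?N = numer \<alpha> \<and> partial_side \<alpha> False ?N = denom \<alpha>"
    using eq cop[of True] cop[of False]
    by (subst (asm) coprime_crossproduct_nat) (auto simp: side_def coprime_commute)
  then show ?thesis by (cases b) (auto simp: side_def)
qed

lemma partial_rat_num_primes:
  assumes "\<alpha> > 0"
  shows "partial_rat \<alpha> (num_primes \<alpha>) = \<alpha>"
proof -
  have "\<alpha> = of_int (fst (quotient_of \<alpha>)) / of_int (snd (quotient_of \<alpha>))"
    by (metis prod.collapse quotient_of_div)
  moreover have "fst (quotient_of \<alpha>) > 0" using assms by (rule quotient_of_pos)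
  moreover have "snd (quotient_of \<alpha>) > 0" by (rule quotient_of_denom_pos')
  ultimately show ?thesis
    using assms by (simp add: partial_rat_eq partial_side_num_primes side_def numer_def denom_def)
qed

section \<open>Factorizations as pairs of products\<close>

text \<open>Over an infinite support the product takes the default value 1, so finiteness of the
  support has to be carried along separately.\<close>

definition side_total :: "bool \<Rightarrow> frac_seq \<Rightarrow> nat" where
  "side_total b A = (\<Prod>i | A i \<noteq> (1, 1). side b (A i))"

lemma side_total_superset:
  assumes "finite S" "{i. A i \<noteq> (1, 1)} \<subseteq> S"
  shows "side_total b A = (\<Prod>i\<in>S. side b (A i))"
  unfolding side_total_def using assms by (intro prod.mono_neutral_left) auto

lemma side_dvd_side_total:
  assumes "finite {i. A i \<noteq> (1, 1)}"
  shows "side b (A i) dvd side_total b A"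
  using assms by (cases "A i = (1, 1)") (auto simp: side_total_def intro: dvd_prodI)

lemma side_total_scale:
  assumes "finite {i. A i \<noteq> (1, 1)}"
  shows "side_total b (A(k := scale b' p (A k))) = side_total b A * (if b' = b then p else 1)"
proof -
  \<comment> \<open>Scaling can bring \<open>k\<close> into the support, so both products are taken
    over the support of \<open>A\<close> enlarged by \<open>k\<close>.\<close>
  define S where "S = insert k {i. A i \<noteq> (1, 1)}"
  define C where "C = A(k := scale b' p (A k))"
  have S: "finite S" "k \<in> S" "{i. A i \<noteq> (1, 1)} \<subseteq> S" "{i. C i \<noteq> (1, 1)} \<subseteq> S"
    using assms by (auto simp: S_def C_def)
  have "side b (C i) = side b (A i) * (if i = k then if b' = b then p else 1 else 1)" for i
    by (simp add: C_def side_scale)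
  then have "(\<Prod>i\<in>S. side b (C i)) = (\<Prod>i\<in>S. side b (A i)) * (if b' = b then p else 1)"
    using S(1,2) by (simp only: prod.distrib prod.delta if_True)
  then show ?thesis
    using S side_total_superset[of S A b] side_total_superset[of S C b] by (simp add: C_def)
qed

text \<open>A fraction in lowest terms determines its numerator and denominator, so the equation
  between rationals splits into two equations between natural numbers.\<close>

lemma factorization_iff:
  assumes "n \<le> num_primes \<alpha>"
  shows "factorization (partial_rat \<alpha> n) A \<longleftrightarrow>
    finite {i. A i \<noteq> (1, 1)} \<and> (\<forall>b. side_total b A = partial_side \<alpha> b n) \<and>
    (\<forall>i. frac_max (A (Suc i)) \<le> frac_max (A i))" (is "?L \<longleftrightarrow> ?R")
proof -
  have quot: "(\<Prod>i | A i \<noteq> (1, 1). of_nat (fst (A i)) / of_nat (snd (A i)))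
      = (of_nat (side_total True A) / of_nat (side_total False A) :: rat)"
    by (simp add: side_total_def side_def prod_dividef)
  note pos = partial_side_pos[OF assms]
  show ?thesis
  proof
    assume L: ?L
    then have fin: "finite {i. A i \<noteq> (1, 1)}" by (simp add: factorization_def)
    have "coprime (side_total True A) (side_total False A)"
      using L by (auto simp: factorization_def side_total_def side_def
          intro!: prod_coprime_left prod_coprime_right)
    moreover have "side_total False A > 0"
      using L by (auto simp: factorization_def side_total_def side_def)
    moreover have "(of_nat (side_total True A) / of_nat (side_total False A) :: rat) =
        of_nat (partial_side \<alpha> True n) / of_nat (partial_side \<alpha> False n)"
      using L quot by (simp add: factorization_def partial_rat_eq)
    ultimately have "side_total True A * partial_side \<alpha> False n = partial_side \<alpha> True n * side_total False A"
      using pos[of False] by (simp add: frac_eq_eq flip: of_nat_mult)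
    then have "side_total True A = partial_side \<alpha> True n \<and> side_total False A = partial_side \<alpha> False n"
      using \<open>coprime (side_total True A) _\<close> coprime_partial_side[OF assms, of True]
      by (subst (asm) coprime_crossproduct_nat) (auto simp: coprime_commute)
    then show ?R using L by (auto simp: factorization_def all_bool_eq)
  next
    assume R: ?R
    \<comment> \<open>Each entry divides a partial side on its own side of the fraction bar;
      positivity and coprimality of the entries follow from those of the partial sides.\<close>
    then have dv: "side b (A i) dvd partial_side \<alpha> b n" for b i
      by (metis side_dvd_side_total)
    have pos_A: "side b (A i) > 0" for b i
      using dv pos by (metis dvd_pos_nat)
    have "fst (A i) > 0" "snd (A i) > 0" for i
      using pos_A[of True i] pos_A[of False i] by (simp_all add: side_def)
    moreover have "coprime (side b (A i)) (side (\<not> b) (A j))" for b i j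
      using dv coprime_partial_side[OF assms] by (meson coprime_divisors)
    from this[of True] have "coprime (fst (A i)) (snd (A j))" for i j
      by (simp add: side_def)
    ultimately show ?L
      unfolding factorization_def quot using R
      by (auto simp: partial_rat_eq side_def split: if_splits)
  qed
qed

lemma side_total_factorization:
  "\<lbrakk>factorization (partial_rat \<alpha> n) A; n \<le> num_primes \<alpha>\<rbrakk> \<Longrightarrow> side_total b A = partial_side \<alpha> b n"
  by (simp add: factorization_iff)

lemma factorization_support:
  "factorization \<beta> A \<Longrightarrow> finite {i. A i \<noteq> (1, 1)}"
  by (simp add: factorization_def)

lemma factorization_antimono:
  assumes "factorization \<beta> A" "i \<le> j"
  shows "frac_max (A j) \<le> frac_max (A i)"
  using assms(1) lift_Suc_antimono_le[of "\<lambda>i. frac_max (A i)", OF _ assms(2)]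
  unfolding factorization_def by blast

lemma factorization_side_pos: "factorization \<beta> A \<Longrightarrow> side b (A i) > 0"
  by (simp add: factorization_def side_def)

lemma factorization_coprime:
  "factorization \<beta> A \<Longrightarrow> coprime (side b (A i)) (side (\<not> b) (A j))"
  by (simp add: factorization_def side_def coprime_commute)

lemma frac_max_eq_one:
  "factorization \<beta> A \<Longrightarrow> frac_max (A i) = 1 \<longleftrightarrow> A i = (1, 1)"
  using factorization_side_pos[of \<beta> A True i] factorization_side_pos[of \<beta> A False i]
  by (auto simp: side_def prod_eq_iff max_def split: if_splits)

text \<open>Primes in the entries come from the first \<open>m\<close> places of a non-increasing
  list. The bound \<open>m \<le> Suc n\<close> covers the factorizations both before and after the
  new prime is added.\<close>

lemma factorization_prime_bound:
  assumes A: "factorization (partial_rat \<alpha> m) A" and m: "m \<le> Suc n" "n < num_primes \<alpha>"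
    and q: "prime q" "q dvd side b (A i)"
  shows "prime_list \<alpha> ! n \<le> q"
proof -
  have le: "m \<le> num_primes \<alpha>" using m by simp
  have "q dvd side_total b A"
    using q(2) side_dvd_side_total[OF factorization_support[OF A]] by (rule dvd_trans)
  then have "q dvd partial_side \<alpha> b m"
    using A le by (simp add: side_total_factorization)
  then obtain j where "j < m" "q = prime_list \<alpha> ! j"
    using prime_dvd_partial_side[OF q(1) _ le] by blast
  then show ?thesis using m by (simp add: prime_list_antimono)
qed

text \<open>Numerator times denominator grows by a prime factor at each step, and \<open>A\<close>
  determines this product.\<close>

lemma factorization_index_unique:
  assumes "factorization (partial_rat \<alpha> m) A" "factorization (partial_rat \<alpha> n) A"
    "m \<le> num_primes \<alpha>" "n \<le> num_primes \<alpha>"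
  shows "m = n"
proof -
  let ?f = "\<lambda>n. partial_side \<alpha> True n * partial_side \<alpha> False n"
  have "?f m < ?f n" if "m < n" "n \<le> num_primes \<alpha>" for m n
    using that
  proof (induction n)
    case (Suc n)
    have "?f n < ?f n * prime_list \<alpha> ! n"
      using Suc.prems partial_side_pos[of n \<alpha>] prime_gt_1_nat[OF prime_list_prime[of n \<alpha>]]
      by simp
    also have "\<dots> = ?f (Suc n)" by (simp add: partial_side_Suc)
    finally show ?case using Suc by (cases "m = n") auto
  qed simp
  moreover have "?f m = ?f n"
    using assms side_total_factorization[of \<alpha> m A] side_total_factorization[of \<alpha> n A] by simp
  ultimately show ?thesis using assms(3,4) by (metis less_irrefl nat_neq_iff)
qed

section \<open>The step from one partial product to the next\<close>

definition extend :: "rat \<Rightarrow> nat \<Rightarrow> frac_seq \<Rightarrow> nat \<Rightarrow> frac_seq" where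
  "extend \<alpha> n A k = A(k := scale (on_top \<alpha> n) (prime_list \<alpha> ! n) (A k))"

lemma extend_same [simp]: "extend \<alpha> n A k k = scale (on_top \<alpha> n) (prime_list \<alpha> ! n) (A k)"
  and extend_other [simp]: "i \<noteq> k \<Longrightarrow> extend \<alpha> n A k i = A i"
  by (simp_all add: extend_def)

lemma direct_subfactorization_iff:
  "direct_subfactorization \<alpha> A C \<longleftrightarrow>
     (\<exists>n<num_primes \<alpha>. factorization (partial_rat \<alpha> n) A \<and>
        factorization (partial_rat \<alpha> (Suc n)) C \<and> (\<exists>k. C = extend \<alpha> n A k))"
proof -
  have "(on_top \<alpha> n \<and>
           (\<exists>k. (\<forall>i. snd (C i) = snd (A i)) \<and> (\<forall>i. i \<noteq> k \<longrightarrow> fst (C i) = fst (A i)) \<and>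
                fst (C k) = fst (A k) * prime_list \<alpha> ! n) \<or>
         prime_list \<alpha> ! n dvd denom \<alpha> \<and>
           (\<exists>k. (\<forall>i. fst (C i) = fst (A i)) \<and> (\<forall>i. i \<noteq> k \<longrightarrow> snd (C i) = snd (A i)) \<and>
                snd (C k) = snd (A k) * prime_list \<alpha> ! n)) \<longleftrightarrow> (\<exists>k. C = extend \<alpha> n A k)"
    if "n < num_primes \<alpha>" for n
  proof (cases "on_top \<alpha> n")
    case True
    have "(\<forall>i. snd (C i) = snd (A i)) \<and> (\<forall>i. i \<noteq> k \<longrightarrow> fst (C i) = fst (A i)) \<and>
        fst (C k) = fst (A k) * prime_list \<alpha> ! n \<longleftrightarrow> C = extend \<alpha> n A k" for k
      using True by (auto simp: extend_def scale_def fun_eq_iff prod_eq_iff)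
    then show ?thesis using True prime_list_dvd_denom_iff[OF that] by simp
  next
    case False
    have "(\<forall>i. fst (C i) = fst (A i)) \<and> (\<forall>i. i \<noteq> k \<longrightarrow> snd (C i) = snd (A i)) \<and>
        snd (C k) = snd (A k) * prime_list \<alpha> ! n \<longleftrightarrow> C = extend \<alpha> n A k" for k
      using False by (auto simp: extend_def scale_def fun_eq_iff prod_eq_iff)
    then show ?thesis using False prime_list_dvd_denom_iff[OF that] by simp
  qed
  then show ?thesis unfolding direct_subfactorization_def by blast
qed

text \<open>The maxima are non-increasing, so the first entry \<open>(1, 1)\<close> is followed by
  such entries only.\<close>

lemma seq_length_eqI:
  assumes "factorization \<beta> A" "A k = (1, 1)" "\<And>j. j < k \<Longrightarrow> A j \<noteq> (1, 1)"
  shows "seq_length A = k"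
  unfolding seq_length_def
proof (rule Least_equality)
  show "\<forall>i\<ge>k. A i = (1, 1)"
  proof (intro allI impI)
    fix i assume "k \<le> i"
    then have "frac_max (A i) \<le> frac_max (A k)" using assms(1) by (rule factorization_antimono[rotated])
    then have "frac_max (A i) \<le> 1" by (simp add: assms(2))
    moreover have "fst (A i) > 0" "snd (A i) > 0"
      using assms(1) by (simp_all add: factorization_def)
    ultimately show "A i = (1, 1)" by (simp add: prod_eq_iff)
  qed
next
  fix y assume "\<forall>i\<ge>y. A i = (1, 1)"
  then show "k \<le> y" using assms(3) by (meson not_le order_refl)
qed

lemma at_seq_length:
  assumes "finite {i. A i \<noteq> (1, 1)}"
  shows "A (seq_length A) = (1, 1)"
proof -
  obtain l where "\<forall>i\<in>{i. A i \<noteq> (1, 1)}. i < l"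
    using assms finite_nat_set_iff_bounded by blast
  then have "\<exists>l. \<forall>i\<ge>l. A i = (1, 1)" by (metis mem_Collect_eq not_less)
  then have "\<forall>i\<ge>seq_length A. A i = (1, 1)" unfolding seq_length_def by (rule LeastI_ex)
  then show ?thesis by simp
qed

text \<open>The entry at \<open>seq_length A\<close> is \<open>(1, 1)\<close>, so appending the new
  prime is an extension at that position.\<close>

lemma Delta_iff:
  "C \<in> Delta \<alpha> A \<longleftrightarrow> (\<exists>n<num_primes \<alpha>. factorization (partial_rat \<alpha> n) A \<and>
     (\<exists>k. C = extend \<alpha> n A k \<and>
        (side (on_top \<alpha> n) (A k) * prime_list \<alpha> ! n < side (\<not> on_top \<alpha> n) (A k) \<or>
         k = seq_length A)))"
proof -
  have "delta \<alpha> n A = {extend \<alpha> n A k | k.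
      side (on_top \<alpha> n) (A k) * prime_list \<alpha> ! n < side (\<not> on_top \<alpha> n) (A k)}" for n
    by (simp add: delta_def extend_def scale_def side_def Let_def)
  moreover have "epsilon \<alpha> n A = {extend \<alpha> n A (seq_length A)}"
    if "factorization (partial_rat \<alpha> n) A" for n
    using at_seq_length[OF factorization_support[OF that]]
    by (simp add: epsilon_def extend_def scale_def Let_def)
  ultimately have "delta \<alpha> n A \<union> epsilon \<alpha> n A = {C. \<exists>k. C = extend \<alpha> n A k \<and>
        (side (on_top \<alpha> n) (A k) * prime_list \<alpha> ! n < side (\<not> on_top \<alpha> n) (A k) \<or>
         k = seq_length A)}" if "factorization (partial_rat \<alpha> n) A" for n
    using that by auto
  then show ?thesis unfolding Delta_def by blast
qed

section \<open>Adding a prime and primitivity\<close>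

lemma extend_side_neq:
  assumes "factorization (partial_rat \<alpha> n) A" "n < num_primes \<alpha>"
    "factorization (partial_rat \<alpha> (Suc n)) (extend \<alpha> n A k)"
  shows "side (on_top \<alpha> n) (A k) * prime_list \<alpha> ! n \<noteq> side (\<not> on_top \<alpha> n) (A k)"
proof
  let ?b = "on_top \<alpha> n" and ?p = "prime_list \<alpha> ! n"
  assume eq: "side ?b (A k) * ?p = side (\<not> ?b) (A k)"
  \<comment> \<open>Coprimality forces the two equal sides to be 1, yet one of them is a multiple of
    a prime.\<close>
  have "coprime (side ?b (extend \<alpha> n A k k)) (side (\<not> ?b) (extend \<alpha> n A k k))"
    using assms(3) by (rule factorization_coprime)
  then have "side (\<not> ?b) (A k) = 1" using eq by (simp add: side_scale)
  then show False using eq prime_list_prime[OF assms(2)] by simp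
qed

text \<open>If the new prime does not stay on the strictly smaller side, it makes its side the
  maximum of the entry. Primitivity then leaves room for no other factor there, and minimality of
  the new prime for none on the opposite side, so the entry was \<open>(1, 1)\<close>.\<close>

lemma extend_in_Delta:
  assumes A: "primitive_factorization (partial_rat \<alpha> n) A" and n: "n < num_primes \<alpha>"
    and C: "primitive_factorization (partial_rat \<alpha> (Suc n)) (extend \<alpha> n A k)"
  shows "extend \<alpha> n A k \<in> Delta \<alpha> A"
proof -
  let ?b = "on_top \<alpha> n" and ?p = "prime_list \<alpha> ! n" and ?C = "extend \<alpha> n A k"
  have fA: "factorization (partial_rat \<alpha> n) A" and fC: "factorization (partial_rat \<alpha> (Suc n)) ?C"
    using A C by (simp_all add: primitive_factorization_def)
  have p: "prime ?p" using n by (rule prime_list_prime)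
  show ?thesis
  proof (cases "side ?b (A k) * ?p < side (\<not> ?b) (A k)")
    case True
    then show ?thesis using fA n by (auto simp: Delta_iff)
  next
    case False
    then have lt: "side (\<not> ?b) (A k) < side ?b (A k) * ?p"
      using extend_side_neq[OF fA n fC] by linarith
    have max_k: "frac_max (?C k) = side ?b (A k) * ?p"
      using lt by (simp add: frac_max_side[of _ ?b] side_scale)
    have "side ?b (A k) * ?p \<noteq> 1" using p by auto
    then have "prime (side ?b (A k) * ?p)"
      using C max_k unfolding primitive_factorization_def by metis
    then have one: "side ?b (A k) = 1"
      using prime_product[of "side ?b (A k)" ?p] p by (auto simp: prime_nat_iff)
    \<comment> \<open>This side is less than \<open>?p\<close>, while each of its prime factors is
      at least \<open>?p\<close>.\<close>
    have "side (\<not> ?b) (A k) = 1"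
    proof (rule ccontr)
      assume "side (\<not> ?b) (A k) \<noteq> 1"
      then obtain q where "prime q" "q dvd side (\<not> ?b) (A k)" using prime_factor_nat by blast
      then have "?p \<le> side (\<not> ?b) (A k)"
        using factorization_prime_bound[OF fA le_SucI[OF order_refl] n] factorization_side_pos[OF fA]
        by (meson dvd_imp_le order_trans)
      then show False using lt one by simp
    qed
    then have Ak: "A k = (1, 1)"
      using one by (cases ?b) (auto simp: side_def prod_eq_iff)
    \<comment> \<open>An earlier entry \<open>(1, 1)\<close> would survive in \<open>?C\<close> in
      front of one with maximum \<open>?p\<close>.\<close>
    have "A j \<noteq> (1, 1)" if "j < k" for j
    proof
      assume Aj: "A j = (1, 1)"
      have "frac_max (?C k) \<le> frac_max (?C j)"
        using fC that by (intro factorization_antimono) auto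
      then have "side ?b (A k) * ?p \<le> frac_max (A j)"
        unfolding max_k using that by simp
      then show False using Aj one prime_gt_1_nat[OF p] by simp
    qed
    then have "seq_length A = k" using seq_length_eqI[OF fA Ak] by blast
    then show ?thesis using fA n by (auto simp: Delta_iff)
  qed
qed

text \<open>A \<open>delta\<close> step keeps the maximum of the changed entry, and an
  \<open>epsilon\<close> step creates an entry whose maximum is the new prime.\<close>

lemma Delta_primitive:
  assumes A: "primitive_factorization \<beta> A" and C: "factorization \<gamma> C" and CA: "C \<in> Delta \<alpha> A"
  shows "primitive_factorization \<gamma> C"
proof -
  obtain n k where n: "n < num_primes \<alpha>" and fA: "factorization (partial_rat \<alpha> n) A"
    and Ceq: "C = extend \<alpha> n A k"
    and or: "side (on_top \<alpha> n) (A k) * prime_list \<alpha> ! n < side (\<not> on_top \<alpha> n) (A k) \<or>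
         k = seq_length A"
    using CA unfolding Delta_iff by blast
  let ?b = "on_top \<alpha> n" and ?p = "prime_list \<alpha> ! n"
  have p: "prime ?p" using n by (rule prime_list_prime)
  have "prime (frac_max (C i)) \<or> frac_max (C i) = 1" for i
  proof (cases "i = k")
    case False
    then show ?thesis using A unfolding Ceq by (simp add: primitive_factorization_def)
  next
    case True
    from or show ?thesis
    proof
      assume lt: "side ?b (A k) * ?p < side (\<not> ?b) (A k)"
      have "side ?b (A k) \<le> side ?b (A k) * ?p" using prime_gt_0_nat[OF p] by simp
      then have "side ?b (A k) \<le> side (\<not> ?b) (A k)" using lt by linarith
      then have "frac_max (C k) = frac_max (A k)"
        using lt by (simp add: Ceq frac_max_side[of _ ?b] side_scale)
      then show ?thesis using A True by (simp add: primitive_factorization_def)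
    next
      assume "k = seq_length A"
      then have "A k = (1, 1)" using at_seq_length[OF factorization_support[OF fA]] by simp
      then have "frac_max (C k) = ?p"
        using prime_gt_0_nat[OF p] by (simp add: Ceq frac_max_side[of _ ?b] side_scale)
      then show ?thesis using p True by simp
    qed
  qed
  then show ?thesis using C by (simp add: primitive_factorization_def)
qed

section \<open>Removing the newest prime\<close>

lemma factorization_extendD:
  assumes C: "factorization (partial_rat \<alpha> (Suc n)) (extend \<alpha> n A k)" and n: "n < num_primes \<alpha>"
    and anti: "\<And>i. frac_max (A (Suc i)) \<le> frac_max (A i)"
  shows "factorization (partial_rat \<alpha> n) A"
proof -
  let ?b = "on_top \<alpha> n" and ?p = "prime_list \<alpha> ! n" and ?C = "extend \<alpha> n A k"
  have p: "?p > 0" using prime_list_prime[OF n] by (rule prime_gt_0_nat)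
  have "finite {i. ?C i \<noteq> (1, 1)}" using C by (rule factorization_support)
  then have "finite (insert k {i. ?C i \<noteq> (1, 1)})" by simp
  then have fin: "finite {i. A i \<noteq> (1, 1)}"
    by (rule finite_subset[rotated]) (auto simp: extend_def)
  \<comment> \<open>Both totals of the extension carry the same extra factor, \<open>?p\<close> or
    1, which cancels.\<close>
  have "side_total b A = partial_side \<alpha> b n" for b
  proof -
    have "side_total b ?C = partial_side \<alpha> b (Suc n)"
      using C n by (simp add: factorization_iff)
    then show ?thesis
      using p by (auto simp: extend_def side_total_scale[OF fin] partial_side_Suc split: if_splits)
  qed
  then show ?thesis using n fin anti by (simp add: factorization_iff)
qed

lemma primitive_predecessor:
  assumes n: "n < num_primes \<alpha>" and C: "primitive_factorization (partial_rat \<alpha> (Suc n)) C"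
  obtains A where "primitive_factorization (partial_rat \<alpha> n) A" "C \<in> Delta \<alpha> A"
proof -
  note found = that
  let ?b = "on_top \<alpha> n" and ?p = "prime_list \<alpha> ! n"
  have p: "prime ?p" using n by (rule prime_list_prime)
  have fC: "factorization (partial_rat \<alpha> (Suc n)) C"
    using C by (simp add: primitive_factorization_def)
  have fin: "finite {i. C i \<noteq> (1, 1)}" using fC by (rule factorization_support)
  have prim: "prime (frac_max (C i)) \<or> frac_max (C i) = 1" for i
    using C by (simp add: primitive_factorization_def)
  have step: thesis if "C = extend \<alpha> n A k"
    and "\<And>i. frac_max (A (Suc i)) \<le> frac_max (A i)"
    and "\<And>i. prime (frac_max (A i)) \<or> frac_max (A i) = 1" for A k
  proof -
    have "primitive_factorization (partial_rat \<alpha> n) A"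
      using factorization_extendD[of \<alpha> n A k] fC n that by (simp add: primitive_factorization_def)
    then show thesis using extend_in_Delta[of \<alpha> n A k] n C that(1) found by blast
  qed
  have pos: "side b (C i) > 0" for b i using fC by (rule factorization_side_pos)
  have bound: "?p \<le> q" if "prime q" "q dvd side b (C i)" for q b i
    using factorization_prime_bound[OF fC order_refl n that] .
  have "?p dvd partial_side \<alpha> ?b (Suc n)" by (simp add: partial_side_Suc)
  then have "?p dvd side_total ?b C" using fC n by (simp add: factorization_iff)
  then obtain k0 where k0: "?p dvd side ?b (C k0)"
    using p fin by (auto simp: side_total_def prime_dvd_prod_iff)
  show thesis
  proof (cases "frac_max (C k0) = ?p")
    case True
    \<comment> \<open>The entries from \<open>k0\<close> to the last nontrivial position
      \<open>k\<close> all have maximum \<open>?p\<close>. Dropping the last of them, rather than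
      the one at \<open>k0\<close>, leaves no gap in the sequence.\<close>
    define k where "k = Max {i. C i \<noteq> (1, 1)}"
    have k0_supp: "k0 \<in> {i. C i \<noteq> (1, 1)}" using True prime_gt_1_nat[OF p] by auto
    then have "k \<in> {i. C i \<noteq> (1, 1)}" unfolding k_def using fin by (intro Max_in) auto
    moreover have "k0 \<le> k" unfolding k_def using fin k0_supp by (rule Max_ge)
    ultimately have k: "C k \<noteq> (1, 1)" "k0 \<le> k" by simp_all
    have after: "C i = (1, 1)" if "i > k" for i
      using Max_ge[OF fin, of i] that by (auto simp: k_def)
    have "frac_max (C k) \<le> ?p" using factorization_antimono[OF fC k(2)] True by simp
    moreover have pk: "prime (frac_max (C k))" using prim k(1) frac_max_eq_one[OF fC] by blast
    moreover have "frac_max (C k) = side True (C k) \<or> frac_max (C k) = side False (C k)"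
      by (auto simp: side_def max_def)
    ultimately have mk: "frac_max (C k) = ?p"
      using bound by (metis dvd_refl le_antisym)
    \<comment> \<open>Since \<open>?p\<close> divides side \<open>?b\<close> of entry
      \<open>k0\<close>, coprimality across entries bars it from the opposite side of entry
      \<open>k\<close>.\<close>
    have "?p \<noteq> side (\<not> ?b) (C k)"
    proof
      assume "?p = side (\<not> ?b) (C k)"
      then have "?p dvd side (\<not> ?b) (C k)" by simp
      then show False
        using k0 factorization_coprime[OF fC, of ?b k0 k] p by (metis coprime_common_divisor not_prime_unit)
    qed
    then have sb: "side ?b (C k) = ?p" and lt: "side (\<not> ?b) (C k) < ?p"
      using mk unfolding frac_max_side[of _ ?b] by (auto simp: max_def split: if_splits)
    have sn: "side (\<not> ?b) (C k) = 1"
    proof (rule ccontr)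
      assume "side (\<not> ?b) (C k) \<noteq> 1"
      then obtain q where "prime q" "q dvd side (\<not> ?b) (C k)" using prime_factor_nat by blast
      then show False using bound lt pos by (meson dvd_imp_le not_le order_trans)
    qed
    let ?A = "C(k := (1, 1))"
    have "C = extend \<alpha> n ?A k"
      using sb sn by (auto simp: extend_def fun_eq_iff scale_def side_def prod_eq_iff split: if_splits)
    \<comment> \<open>Only the neighbours of \<open>k\<close> matter: the entry after it is
      \<open>(1, 1)\<close>, and the maximum before it is at least 1.\<close>
    moreover have "frac_max (?A (Suc i)) \<le> frac_max (?A i)" for i
      using factorization_antimono[OF fC, of i "Suc i"] after[of "Suc k"] pos[of True i] pos[of False i]
      by (auto simp: side_def)
    moreover have "prime (frac_max (?A i)) \<or> frac_max (?A i) = 1" for i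
      using prim by auto
    ultimately show thesis by (rule step)
  next
    case False
    \<comment> \<open>As the maximum, this side would be a prime divisible by \<open>?p\<close>,
      hence \<open>?p\<close> itself.\<close>
    have "side ?b (C k0) \<noteq> frac_max (C k0)"
    proof
      assume eq: "side ?b (C k0) = frac_max (C k0)"
      then have "frac_max (C k0) \<noteq> 1" using k0 p by auto
      then have "prime (side ?b (C k0))" using prim eq by metis
      then show False using k0 p eq False by (metis primes_dvd_imp_eq)
    qed
    then have lt: "side ?b (C k0) < side (\<not> ?b) (C k0)"
      unfolding frac_max_side[of _ ?b] by (auto simp: max_def split: if_splits)
    obtain m where m: "side ?b (C k0) = m * ?p" using k0 by (metis dvd_div_mult_self)
    then have "m \<le> side ?b (C k0)" using prime_gt_0_nat[OF p] by simp
    let ?A = "C(k0 := (if ?b then (m, snd (C k0)) else (fst (C k0), m)))"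
    have "C = extend \<alpha> n ?A k0"
      using m by (auto simp: extend_def fun_eq_iff scale_def side_def prod_eq_iff)
    \<comment> \<open>The prime is cancelled on the smaller side, so monotonicity and primitivity
      carry over from \<open>C\<close>.\<close>
    moreover have mx: "frac_max (?A i) = frac_max (C i)" for i
      using lt \<open>m \<le> _\<close> by (auto simp: side_def max_def split: if_splits)
    moreover have "frac_max (?A (Suc i)) \<le> frac_max (?A i)" for i
      unfolding mx using factorization_antimono[OF fC] by simp
    moreover have "prime (frac_max (?A i)) \<or> frac_max (?A i) = 1" for i
      unfolding mx by (rule prim)
    ultimately show thesis by (intro step)
  qed
qed

section \<open>Unique predecessors for square-free rationals\<close>

lemma squarefree_partial_side:
  assumes "\<alpha> > 0" "squarefree_rat \<alpha>" "n \<le> num_primes \<alpha>"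
  shows "squarefree (partial_side \<alpha> b n)"
proof -
  have "partial_side \<alpha> b n dvd partial_side \<alpha> b (num_primes \<alpha>)"
    unfolding partial_side_def using assms(3) by (intro prod_dvd_prod_subset) auto
  moreover have "squarefree (partial_side \<alpha> b (num_primes \<alpha>))"
    using assms(1,2) by (simp add: partial_side_num_primes squarefree_rat_def side_def)
  ultimately show ?thesis using squarefree_mono by blast
qed

text \<open>If the two positions differed, both entries of \<open>C\<close> would be divisible by the new prime, whose
  square would then divide the numerator or the denominator of \<open>\<alpha>\<close>.\<close>

lemma extend_inject:
  assumes "\<alpha> > 0" "squarefree_rat \<alpha>" and n: "n < num_primes \<alpha>"
    and C: "factorization (partial_rat \<alpha> (Suc n)) C"
    and eq: "C = extend \<alpha> n A k" "C = extend \<alpha> n A' k'"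
  shows "A = A'"
proof -
  let ?b = "on_top \<alpha> n" and ?p = "prime_list \<alpha> ! n"
  have p: "prime ?p" using n by (rule prime_list_prime)
  have fin: "finite {i. C i \<noteq> (1, 1)}" using C by (rule factorization_support)
  have "k = k'"
  proof (rule ccontr)
    assume "k \<noteq> k'"
    have dv: "?p dvd side ?b (C k)" "?p dvd side ?b (C k')"
      by (subst eq(1), simp add: side_scale) (subst eq(2), simp add: side_scale)
    let ?S = "insert k (insert k' {i. C i \<noteq> (1, 1)})"
    have "?p ^ 2 dvd (\<Prod>i\<in>{k, k'}. side ?b (C i))"
      using dv \<open>k \<noteq> k'\<close> by (simp add: power2_eq_square mult_dvd_mono)
    also have "\<dots> dvd (\<Prod>i\<in>?S. side ?b (C i))"
      using fin by (intro prod_dvd_prod_subset) auto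
    also have "\<dots> = side_total ?b C"
      using fin by (intro side_total_superset[symmetric]) auto
    also have "\<dots> = partial_side \<alpha> ?b (Suc n)"
      using C n by (simp add: factorization_iff)
    finally show False
      using squarefree_partial_side[OF assms(1,2), of "Suc n" ?b] n p
      by (metis Suc_leI not_prime_unit squarefree_def)
  qed
  then have "A i = A' i" for i
    using eq prime_gt_0_nat[OF p] by (cases "i = k") (metis extend_same scale_inject, metis extend_other)
  then show ?thesis by blast
qed

section \<open>Rooted trees\<close>

locale rooted =
  fixes T :: "('v, 'x) tree_data"
  assumes rooted: "rooted_tree (graph T) (root T)"
begin

lemma root_in_vertices: "root T \<in> vertices T"
  using rooted by (simp add: rooted_tree_def)

lemma edge_vertices:
  assumes "(u, v) \<in> edges T"
  shows "u \<in> vertices T" "v \<in> vertices T" "v \<noteq> root T"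
proof -
  have "pair_wf_digraph (graph T)" using rooted by (simp add: rooted_tree_def)
  then show "u \<in> vertices T" "v \<in> vertices T"
    using assms by (auto simp: pair_wf_digraph_def)
  show "v \<noteq> root T" using assms rooted by (auto simp: rooted_tree_def)
qed

lemma edge_parent_unique: "\<lbrakk>(u, v) \<in> edges T; (u', v) \<in> edges T\<rbrakk> \<Longrightarrow> u = u'"
  using rooted edge_vertices[of u v] unfolding rooted_tree_def by blast

lemma parent_eq: "(u, v) \<in> edges T \<Longrightarrow> parent T v = u"
  unfolding parent_def by (rule the_equality) (auto intro: edge_parent_unique)

lemma parent_edge:
  assumes "v \<in> vertices T" "v \<noteq> root T"
  obtains u where "(u, v) \<in> edges T"
  using assms rooted unfolding rooted_tree_def by blast

text \<open>Reachability from the root turns induction along a path into induction over all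
  vertices, with no finiteness of the tree.\<close>

lemma vertex_induct [consumes 1, case_names root edge]:
  assumes "v \<in> vertices T" "Q (root T)"
    "\<And>u v. \<lbrakk>(u, v) \<in> edges T; Q u\<rbrakk> \<Longrightarrow> Q v"
  shows "Q v"
proof -
  have "reachable (with_proj (graph T)) (root T) v"
    using assms(1) rooted by (simp add: rooted_tree_def)
  then have "(root T, v) \<in> rtrancl_on (vertices T) (edges T)" by (simp add: reachable_def)
  then show ?thesis by (induction rule: rtrancl_on_induct) (use assms(2,3) in auto)
qed

end

locale fact_tree =
  fixes \<alpha> :: rat and T :: "('v, frac_seq) tree_data"
  assumes fact_tree: "factorization_tree \<alpha> T"

sublocale fact_tree \<subseteq> rooted T
  using fact_tree by unfold_locales (simp add: factorization_tree_def tree_data_structure_def)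

context fact_tree
begin

lemma label_root: "label T (root T) = one_seq"
  using fact_tree by (simp add: factorization_tree_def)

lemma label_factorization:
  assumes "v \<in> vertices T"
  obtains n where "n \<le> num_primes \<alpha>" "factorization (partial_rat \<alpha> n) (label T v)"
proof -
  have "label T \<in> vertices T \<rightarrow> Factorizations \<alpha>"
    using fact_tree by (simp add: factorization_tree_def tree_data_structure_def)
  then have "label T v \<in> Factorizations \<alpha>" using assms by (rule funcset_mem)
  then show thesis using that by (auto simp: Factorizations_def)
qed

lemma has_child:
  assumes "v \<in> vertices T" "n < num_primes \<alpha>" "factorization (partial_rat \<alpha> n) (label T v)"
  obtains w where "(v, w) \<in> edges T"
proof -
  have "children T v \<noteq> {}" using assms(1-3) fact_tree unfolding factorization_tree_def by blast
  then show thesis using that by (auto simp: children_def)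
qed

lemma sibling_eq:
  assumes "(u, v) \<in> edges T" "(u, w) \<in> edges T" "label T v = label T w"
  shows "v = w"
proof -
  have "v \<in> vertices T - {root T}" "w \<in> vertices T - {root T}"
    using edge_vertices[OF assms(1)] edge_vertices[OF assms(2)] by simp_all
  moreover have "parent T v = parent T w" using assms(1,2) by (simp add: parent_eq)
  ultimately show ?thesis using fact_tree assms(3) unfolding factorization_tree_def by blast
qed

lemma edge_extend:
  assumes "(u, v) \<in> edges T"
  obtains n k where "n < num_primes \<alpha>" "factorization (partial_rat \<alpha> n) (label T u)"
    "factorization (partial_rat \<alpha> (Suc n)) (label T v)" "label T v = extend \<alpha> n (label T u) k"
proof -
  have "v \<in> vertices T - {root T}" using edge_vertices[OF assms] by simp
  then have "direct_subfactorization \<alpha> (label T (parent T v)) (label T v)"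
    using fact_tree unfolding factorization_tree_def by blast
  then show thesis using that unfolding parent_eq[OF assms] direct_subfactorization_iff by blast
qed

text \<open>The label of a non-root vertex has a prime factor. Hence a homomorphism must send root
  to root.\<close>

lemma label_one_iff:
  assumes "v \<in> vertices T"
  shows "label T v = one_seq \<longleftrightarrow> v = root T"
proof
  assume one: "label T v = one_seq"
  show "v = root T"
  proof (rule ccontr)
    assume "v \<noteq> root T"
    then obtain u where "(u, v) \<in> edges T" using assms parent_edge by blast
    then obtain n A k where n: "n < num_primes \<alpha>" and "label T v = extend \<alpha> n A k"
      using edge_extend by metis
    then have "scale (on_top \<alpha> n) (prime_list \<alpha> ! n) (A k) = (1, 1)"
      using one by (metis extend_same one_seq_def)
    then have "side (on_top \<alpha> n) (A k) * prime_list \<alpha> ! n = 1"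
      by (simp add: scale_def side_def split: if_splits)
    then show False using prime_list_prime[OF n] by simp
  qed
qed (simp add: label_root)

end

section \<open>The maximal tree\<close>

lemma one_seq_factorization: "primitive_factorization (partial_rat \<alpha> 0) one_seq"
  by (simp add: primitive_factorization_def factorization_def one_seq_def partial_rat_def)

text \<open>Both partial sides are empty products, so every entry divides 1.\<close>

lemma factorization_zero:
  assumes "factorization (partial_rat \<alpha> 0) A"
  shows "A = one_seq"
proof
  fix i
  have "side b (A i) dvd 1" for b
    using side_dvd_side_total[OF factorization_support[OF assms], of b i]
      side_total_factorization[OF assms, of b] by (simp add: partial_side_def)
  from this[of True] this[of False] show "A i = one_seq i"
    by (simp add: side_def one_seq_def prod_eq_iff)
qed

locale max_tree = fact_tree \<alpha> P for \<alpha> :: rat and P :: "('v, frac_seq) tree_data" +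
  assumes maximal: "\<lbrakk>r \<in> vertices P; children P r \<noteq> {}\<rbrakk> \<Longrightarrow> label P ` children P r = Delta \<alpha> (label P r)"
begin

lemma edge_Delta:
  assumes "(u, v) \<in> edges P"
  shows "label P v \<in> Delta \<alpha> (label P u)"
proof -
  have "v \<in> children P u" using assms by (simp add: children_def)
  then show ?thesis using maximal[of u] edge_vertices(1)[OF assms] by blast
qed

text \<open>A nonempty \<open>Delta\<close> means that a prime is still to be added; then
  \<open>v\<close> is no leaf and maximality applies to it.\<close>

lemma Delta_child:
  assumes "v \<in> vertices P" "C \<in> Delta \<alpha> (label P v)"
  obtains w where "(v, w) \<in> edges P" "label P w = C"
proof -
  obtain n where "n < num_primes \<alpha>" "factorization (partial_rat \<alpha> n) (label P v)"
    using assms(2) unfolding Delta_iff by blast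
  then obtain u where "(v, u) \<in> edges P" using assms(1) has_child by blast
  then have "children P v \<noteq> {}" by (auto simp: children_def)
  then have "C \<in> label P ` children P v" using maximal assms by simp
  then show thesis using that by (auto simp: children_def)
qed

lemma label_primitive:
  assumes "v \<in> vertices P"
  shows "label P v \<in> Primitive_Factorizations \<alpha>"
  using assms
proof (induction rule: vertex_induct)
  case root
  show ?case using one_seq_factorization by (auto simp: label_root Primitive_Factorizations_def)
next
  case (edge u v)
  obtain \<beta> where "primitive_factorization \<beta> (label P u)"
    using edge.IH by (auto simp: Primitive_Factorizations_def)
  moreover obtain n where n: "n \<le> num_primes \<alpha>" "factorization (partial_rat \<alpha> n) (label P v)"
    using label_factorization edge_vertices(2)[OF edge.hyps] by blast
  ultimately have "primitive_factorization (partial_rat \<alpha> n) (label P v)"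
    using Delta_primitive edge_Delta[OF edge.hyps] by blast
  then show ?case using n(1) by (auto simp: Primitive_Factorizations_def)
qed

text \<open>Induction on the number of primes: the predecessor labels some vertex, and maximality
  provides a child with label \<open>C\<close>.\<close>

lemma primitive_label:
  assumes "primitive_factorization (partial_rat \<alpha> n) C" "n \<le> num_primes \<alpha>"
  shows "C \<in> label P ` vertices P"
  using assms
proof (induction n arbitrary: C)
  case 0
  then have "C = one_seq" by (auto simp: primitive_factorization_def intro: factorization_zero)
  then show ?case using label_root root_in_vertices by (metis image_eqI)
next
  case (Suc n)
  then obtain A where A: "primitive_factorization (partial_rat \<alpha> n) A" "C \<in> Delta \<alpha> A"
    using primitive_predecessor[of n \<alpha> C] by auto
  moreover have "n \<le> num_primes \<alpha>" using Suc.prems by simp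
  ultimately obtain v where "v \<in> vertices P" "label P v = A" using Suc.IH by blast
  then obtain w where "(v, w) \<in> edges P" "label P w = C" using A(2) Delta_child by blast
  then show ?case using edge_vertices by blast
qed

end

lemma primitive_tree_edge_Delta:
  assumes T: "primitive_factorization_tree \<alpha> T" and e: "(u, v) \<in> edges T"
  shows "label T v \<in> Delta \<alpha> (label T u)"
proof -
  interpret fact_tree \<alpha> T
    using T by unfold_locales (simp add: primitive_factorization_tree_def)
  obtain n k where n: "n < num_primes \<alpha>" and A: "factorization (partial_rat \<alpha> n) (label T u)"
    and C: "factorization (partial_rat \<alpha> (Suc n)) (label T v)"
    and eq: "label T v = extend \<alpha> n (label T u) k"
    using edge_extend[OF e] .
  \<comment> \<open>Only the part of primitivity that mentions no index is extracted, to be combined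
    with the indices \<open>n\<close> and \<open>Suc n\<close> that the edge supplies.\<close>
  have prim: "prime (frac_max (label T w i)) \<or> frac_max (label T w i) = 1" if "w \<in> vertices T" for w i
  proof -
    have "label T w \<in> Primitive_Factorizations \<alpha>"
      using T that unfolding primitive_factorization_tree_def by blast
    then show ?thesis by (auto simp: Primitive_Factorizations_def primitive_factorization_def)
  qed
  then have "primitive_factorization (partial_rat \<alpha> n) (label T u)"
    "primitive_factorization (partial_rat \<alpha> (Suc n)) (label T v)"
    using A C edge_vertices[OF e] by (simp_all add: primitive_factorization_def)
  then show ?thesis using extend_in_Delta n eq by metis
qed

section \<open>Homomorphisms into the maximal tree\<close>

text \<open>Primitivity of \<open>T\<close> enters only through \<open>T_Delta\<close>, which makes
  every step in \<open>T\<close> available in \<open>P\<close>.\<close>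

locale prim_tree_pair = max_tree \<alpha> P + T: fact_tree \<alpha> T
  for \<alpha> and P :: "('v, frac_seq) tree_data" and T :: "('w, frac_seq) tree_data" +
  assumes T_Delta: "(u, v) \<in> edges T \<Longrightarrow> label T v \<in> Delta \<alpha> (label T u)"
begin

text \<open>Vertices are related if the paths from the roots to them carry the same labels.\<close>

inductive corr :: "'w \<Rightarrow> 'v \<Rightarrow> bool" where
  root: "corr (root T) (root P)"
| edge: "\<lbrakk>corr u u'; (u, v) \<in> edges T; (u', v') \<in> edges P; label P v' = label T v\<rbrakk> \<Longrightarrow> corr v v'"

lemma corr_label: "corr v v' \<Longrightarrow> label P v' = label T v \<and> v \<in> vertices T \<and> v' \<in> vertices P"
  by (induction rule: corr.induct)
    (auto simp: label_root T.label_root root_in_vertices T.root_in_vertices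
      intro: edge_vertices T.edge_vertices)

lemma corr_exists: "v \<in> vertices T \<Longrightarrow> \<exists>v'. corr v v'"
proof (induction rule: T.vertex_induct)
  case root
  then show ?case using corr.root by blast
next
  case (edge u v)
  then obtain u' where u': "corr u u'" by blast
  then have "label T v \<in> Delta \<alpha> (label P u')" "u' \<in> vertices P"
    using T_Delta[OF edge.hyps] corr_label[OF u'] by simp_all
  then obtain v' where "(u', v') \<in> edges P" "label P v' = label T v" using Delta_child by blast
  then show ?case using corr.edge[OF u' edge.hyps] by blast
qed

text \<open>Parents are unique in \<open>T\<close>, and siblings in \<open>P\<close> with equal
  labels coincide. Exchanging the two trees in this argument gives injectivity.\<close>

lemma corr_unique: "corr v v' \<Longrightarrow> corr v w' \<Longrightarrow> v' = w'"
proof (induction arbitrary: w' rule: corr.induct)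
  case root
  then show ?case
    by (cases rule: corr.cases) (auto dest: T.edge_vertices(3))
next
  case (edge u u' v v')
  from edge.prems show ?case
  proof (cases rule: corr.cases)
    case root
    then show ?thesis using edge.hyps T.edge_vertices(3) by blast
  next
    case (edge x x')
    then have "x = u" using T.edge_parent_unique \<open>(u, v) \<in> edges T\<close> by blast
    then have "x' = u'" using edge \<open>\<And>w'. corr u w' \<Longrightarrow> u' = w'\<close> by blast
    then show ?thesis using sibling_eq edge \<open>(u', v') \<in> edges P\<close> \<open>label P v' = label T v\<close> by metis
  qed
qed

lemma corr_inj: "corr v v' \<Longrightarrow> corr w v' \<Longrightarrow> v = w"
proof (induction arbitrary: w rule: corr.induct)
  case root
  then show ?case
    by (cases rule: corr.cases) (auto dest: edge_vertices(3))
next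
  case (edge u u' v v')
  from edge.prems show ?case
  proof (cases rule: corr.cases)
    case root
    then show ?thesis using edge.hyps edge_vertices(3) by blast
  next
    case (edge x x')
    then have "x' = u'" using edge_parent_unique \<open>(u', v') \<in> edges P\<close> by blast
    then have "x = u" using edge \<open>\<And>w. corr w u' \<Longrightarrow> u = w\<close> by blast
    then show ?thesis using T.sibling_eq edge \<open>(u, v) \<in> edges T\<close> \<open>label P v' = label T v\<close> by metis
  qed
qed

text \<open>Every homomorphism is contained in the relation \<open>corr\<close>, so uniqueness and
  injectivity of homomorphisms reduce to those of \<open>corr\<close>.\<close>

lemma hom_corr:
  assumes "tree_hom T P \<sigma>" "v \<in> vertices T"
  shows "corr v (\<sigma> v)"
  using assms(2)
proof (induction rule: T.vertex_induct)
  case root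
  have "label P (\<sigma> (root T)) = one_seq" "\<sigma> (root T) \<in> vertices P"
    using assms(1) T.root_in_vertices T.label_root by (auto simp: tree_hom_def)
  then show ?case using label_one_iff corr.root by metis
next
  case (edge u v)
  have "(\<sigma> u, \<sigma> v) \<in> edges P" "label P (\<sigma> v) = label T v"
    using assms(1) edge.hyps T.edge_vertices(2) by (auto simp: tree_hom_def)
  then show ?case using corr.edge edge by blast
qed

lemma hom_exists: "\<exists>\<sigma>. tree_hom T P \<sigma>"
proof -
  \<comment> \<open>The restriction makes the map extensional, as \<open>tree_hom\<close>
    demands.\<close>
  define \<sigma> where "\<sigma> = restrict (\<lambda>v. THE v'. corr v v') (vertices T)"
  have \<sigma>: "corr v (\<sigma> v)" if "v \<in> vertices T" for v
  proof -
    have "\<exists>!v'. corr v v'" using corr_exists[OF that] corr_unique by blast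
    then show ?thesis using that by (simp add: \<sigma>_def theI')
  qed
  have "(\<sigma> u, \<sigma> v) \<in> edges P" if e: "(u, v) \<in> edges T" for u v
  proof -
    have "corr u (\<sigma> u)" "corr v (\<sigma> v)" using \<sigma> T.edge_vertices[OF e] by auto
    \<comment> \<open>The last rule used for \<open>v\<close> yields an edge into
      \<open>\<sigma> v\<close>; its source corresponds to \<open>u\<close> and therefore equals
      \<open>\<sigma> u\<close>.\<close>
    from this(2) show ?thesis
    proof (cases rule: corr.cases)
      case root
      then show ?thesis using e T.edge_vertices(3) by blast
    next
      case (edge x x')
      then show ?thesis using e T.edge_parent_unique \<open>corr u (\<sigma> u)\<close> corr_unique by metis
    qed
  qed
  moreover have "\<sigma> v \<in> vertices P" "label P (\<sigma> v) = label T v" if "v \<in> vertices T" for v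
    using corr_label[OF \<sigma>[OF that]] by simp_all
  moreover have "\<sigma> \<in> extensional (vertices T)" by (simp add: \<sigma>_def)
  ultimately have "tree_hom T P \<sigma>" by (simp add: tree_hom_def PiE_def)
  then show ?thesis by blast
qed

lemma hom_unique:
  assumes "tree_hom T P \<sigma>" "tree_hom T P \<tau>"
  shows "\<sigma> = \<tau>"
proof (rule PiE_ext)
  show "\<sigma> \<in> vertices T \<rightarrow>\<^sub>E vertices P" "\<tau> \<in> vertices T \<rightarrow>\<^sub>E vertices P"
    using assms by (simp_all add: tree_hom_def)
qed (use assms hom_corr corr_unique in blast)

lemma hom_inj: "tree_hom T P \<sigma> \<Longrightarrow> inj_on \<sigma> (vertices T)"
  using hom_corr corr_inj by (metis inj_onI)

text \<open>The image of a homomorphism is closed under parents, as the parent of \<open>h\<close>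
  is mapped to the only parent of \<open>\<sigma> h\<close>. This gives edge preservation and, in
  the square-free case, surjectivity.\<close>

lemma hom_edge_lift:
  assumes \<sigma>: "tree_hom T P \<sigma>" and h: "h \<in> vertices T" and e: "(x, \<sigma> h) \<in> edges P"
  obtains g where "(g, h) \<in> edges T" "x = \<sigma> g"
proof -
  have "\<sigma> (root T) = root P"
    using hom_corr[OF \<sigma> T.root_in_vertices] corr.root corr_unique by blast
  then have "h \<noteq> root T" using e edge_vertices(3) by metis
  then obtain g where g: "(g, h) \<in> edges T" using h T.parent_edge by blast
  then have "(\<sigma> g, \<sigma> h) \<in> edges P" using \<sigma> by (simp add: tree_hom_def)
  then show thesis using that g e edge_parent_unique by blast
qed

lemma hom_edge_preserving:
  assumes "tree_hom T P \<sigma>"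
  shows "edge_preserving T P \<sigma>"
  unfolding edge_preserving_def
proof (intro ballI impI)
  fix g h assume gh: "g \<in> vertices T" "h \<in> vertices T" "(\<sigma> g, \<sigma> h) \<in> edges P"
  then obtain g' where "(g', h) \<in> edges T" "\<sigma> g = \<sigma> g'" using hom_edge_lift assms by blast
  then show "(g, h) \<in> edges T"
    using inj_onD[OF hom_inj[OF assms]] gh T.edge_vertices by metis
qed

end

section \<open>The square-free case\<close>

context max_tree
begin

text \<open>A label determines its index and, for square-free \<alpha>, the label of the parent; by
  induction the parents agree, and so do the siblings.\<close>

lemma label_inj:
  assumes pos: "\<alpha> > 0" and sf: "squarefree_rat \<alpha>"
    and v: "v \<in> vertices P" and w: "w \<in> vertices P" and eq: "label P v = label P w"
  shows "v = w"
  using v w eq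
proof (induction arbitrary: w rule: vertex_induct)
  case root
  then show ?case using label_root label_one_iff by metis
next
  case (edge u v)
  have "v \<in> vertices P" "v \<noteq> root P" using edge_vertices[OF edge.hyps] by auto
  then have "w \<noteq> root P" using edge.prems label_one_iff by metis
  then obtain x where x: "(x, w) \<in> edges P" using edge.prems parent_edge by blast
  obtain n k where n: "n < num_primes \<alpha>" "factorization (partial_rat \<alpha> (Suc n)) (label P v)"
    "label P v = extend \<alpha> n (label P u) k"
    using edge_extend[OF edge.hyps] .
  obtain m j where m: "m < num_primes \<alpha>" "factorization (partial_rat \<alpha> (Suc m)) (label P v)"
    "label P v = extend \<alpha> m (label P x) j"
    using edge_extend[OF x] edge.prems by metis
  have "n = m" using factorization_index_unique[OF n(2) m(2)] n(1) m(1) by simp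
  then have "label P u = label P x" using extend_inject[OF pos sf n(1,2,3)] m(3) by blast
  then have "u = x" using edge.IH edge_vertices(1)[OF x] by blast
  then show ?case using sibling_eq edge.hyps x edge.prems by blast
qed

text \<open>Following children from \<open>v\<close> leads to a vertex labelled by a factorization
  of \<alpha>; membership in \<open>S\<close> is then passed back along this path. \<open>S\<close>
  will be the image of a homomorphism.\<close>

lemma descends_to_full:
  assumes pos: "\<alpha> > 0" and v: "v \<in> vertices P"
    and closed: "\<And>u w. \<lbrakk>(u, w) \<in> edges P; w \<in> S\<rbrakk> \<Longrightarrow> u \<in> S"
    and full: "\<And>w. \<lbrakk>w \<in> vertices P; primitive_factorization \<alpha> (label P w)\<rbrakk> \<Longrightarrow> w \<in> S"
  shows "v \<in> S"
proof -
  \<comment> \<open>Downward induction from \<open>num_primes \<alpha>\<close>, where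
    \<open>full\<close> applies to \<open>v\<close> itself.\<close>
  have "v \<in> S" if "n \<le> num_primes \<alpha>" "v \<in> vertices P"
      "primitive_factorization (partial_rat \<alpha> n) (label P v)" for n v
    using that
  proof (induction n arbitrary: v rule: inc_induct)
    case base
    then show ?case using full by (simp add: partial_rat_num_primes[OF pos])
  next
    case (step n)
    have fv: "factorization (partial_rat \<alpha> n) (label P v)"
      using step.prems(2) by (simp add: primitive_factorization_def)
    obtain w where w: "(v, w) \<in> edges P" using has_child[OF step.prems(1) step.hyps(2) fv] .
    have "label P w \<in> Delta \<alpha> (label P v)" using w by (rule edge_Delta)
    obtain m where m: "m < num_primes \<alpha>" "factorization (partial_rat \<alpha> m) (label P v)"
      "factorization (partial_rat \<alpha> (Suc m)) (label P w)"
      using edge_extend[OF w] .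
    have "m = n"
      using factorization_index_unique[OF m(2) fv] step.hyps(2) m(1) by simp
    then have "primitive_factorization (partial_rat \<alpha> (Suc n)) (label P w)"
      using Delta_primitive step.prems(2) m(3) edge_Delta[OF w] by blast
    then show ?case using closed[OF w] step.IH edge_vertices[OF w] by blast
  qed
  moreover obtain n where "n \<le> num_primes \<alpha>" "primitive_factorization (partial_rat \<alpha> n) (label P v)"
    using label_primitive[OF v] by (auto simp: Primitive_Factorizations_def)
  ultimately show ?thesis using v by blast
qed

end

context prim_tree_pair
begin

text \<open>Only surjectivity is missing. A vertex labelled by a factorization of \<alpha> is hit
  because its label occurs in \<open>T\<close> and labels in \<open>P\<close> are unique; its
  ancestors are hit because edges lift.\<close>

lemma isomorphic:
  assumes pos: "\<alpha> > 0" and sf: "squarefree_rat \<alpha>"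
    and all: "{A. primitive_factorization \<alpha> A} \<subseteq> label T ` vertices T"
  shows "tree_isomorphic T P"
proof -
  obtain \<sigma> where \<sigma>: "tree_hom T P \<sigma>" using hom_exists by blast
  have into: "\<sigma> v \<in> vertices P" "label P (\<sigma> v) = label T v" if "v \<in> vertices T" for v
    using \<sigma> that by (auto simp: tree_hom_def)
  have "v \<in> \<sigma> ` vertices T" if "v \<in> vertices P" for v
    using pos that
  proof (rule descends_to_full)
    fix u w assume "(u, w) \<in> edges P" "w \<in> \<sigma> ` vertices T"
    then show "u \<in> \<sigma> ` vertices T" using hom_edge_lift[OF \<sigma>] T.edge_vertices(1) by blast
  next
    fix w assume w: "w \<in> vertices P" "primitive_factorization \<alpha> (label P w)"
    then have "label P w \<in> label T ` vertices T" using all by blast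
    then obtain t where t: "t \<in> vertices T" "label P w = label T t" by (rule imageE)
    have "\<sigma> t = w"
      using label_inj[OF pos sf into(1)[OF t(1)] w(1)] into(2)[OF t(1)] t(2) by simp
    then show "w \<in> \<sigma> ` vertices T" using t(1) by blast
  qed
  then have "bij_betw \<sigma> (vertices T) (vertices P)"
    using hom_inj[OF \<sigma>] into by (auto simp: bij_betw_def)
  then show ?thesis using \<sigma> hom_edge_preserving unfolding tree_isomorphic_def by blast
qed

end

theorem theorem2p6:
  fixes \<alpha> :: rat and P :: "('v, frac_seq) tree_data"
  assumes "\<alpha> > 0"
    and "maximal_primitive_factorization_tree \<alpha> P"
  shows "primitive_factorization_tree \<alpha> P \<and>
    label P ` vertices P = Primitive_Factorizations \<alpha> \<and>
    (\<forall>T :: ('w, frac_seq) tree_data. primitive_factorization_tree \<alpha> T \<longrightarrow>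
       (\<exists>!\<sigma>. tree_hom T P \<sigma>) \<and>
       (\<forall>\<sigma>. tree_hom T P \<sigma> \<longrightarrow> inj_on \<sigma> (vertices T) \<and> edge_preserving T P \<sigma>)) \<and>
    (squarefree_rat \<alpha> \<longrightarrow>
       (\<forall>T :: ('w, frac_seq) tree_data.
          primitive_factorization_tree \<alpha> T \<and>
          {A. primitive_factorization \<alpha> A} \<subseteq> label T ` vertices T \<longrightarrow>
          tree_isomorphic T P))"
proof -
  interpret max_tree \<alpha> P
    using assms(2) by unfold_locales (auto simp: maximal_primitive_factorization_tree_def)
  have pair: "prim_tree_pair \<alpha> P T" if "primitive_factorization_tree \<alpha> T"
    for T :: "('w, frac_seq) tree_data"
  proof
    show "factorization_tree \<alpha> T" using that by (simp add: primitive_factorization_tree_def)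
  qed (rule primitive_tree_edge_Delta[OF that])
  have image: "label P ` vertices P = Primitive_Factorizations \<alpha>"
  proof
    show "label P ` vertices P \<subseteq> Primitive_Factorizations \<alpha>" using label_primitive by blast
    show "Primitive_Factorizations \<alpha> \<subseteq> label P ` vertices P"
      using primitive_label unfolding Primitive_Factorizations_def by blast
  qed
  show ?thesis
  proof (intro conjI allI impI)
    show "primitive_factorization_tree \<alpha> P"
      using fact_tree image by (simp add: primitive_factorization_tree_def)
    show "label P ` vertices P = Primitive_Factorizations \<alpha>" by (rule image)
  next
    fix T :: "('w, frac_seq) tree_data" assume "primitive_factorization_tree \<alpha> T"
    then interpret prim_tree_pair \<alpha> P T by (rule pair)
    show "\<exists>!\<sigma>. tree_hom T P \<sigma>" using hom_exists hom_unique by blast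
    fix \<sigma> assume "tree_hom T P \<sigma>"
    then show "inj_on \<sigma> (vertices T)" "edge_preserving T P \<sigma>"
      by (rule hom_inj, rule hom_edge_preserving)
  next
    fix T :: "('w, frac_seq) tree_data"
    assume sf: "squarefree_rat \<alpha>" and
      T: "primitive_factorization_tree \<alpha> T \<and> {A. primitive_factorization \<alpha> A} \<subseteq> label T ` vertices T"
    then interpret prim_tree_pair \<alpha> P T using pair by blast
    show "tree_isomorphic T P" using isomorphic assms(1) sf T by blast
  qed
qed

end
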